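(* Let $G$ be an abelian totally ordered group with positive cone $G^+$, and let $S\subseteq G^+$ be a subsemigroup containing $0$. Then the regular isometric representation of $S$ is inverse.
   Context: Groups are written additively. A positive cone $G^+$ of an abelian group $G$ is a subsemigroup with $G=G^+\cup(-G^+)$ and $G^+\cap(-G^+)=\{0\}$. The regular isometric representation of $S$ is the map $V:S\to B(l^2(S))$, $a\mapsto V_a$, where $(V_af)(b)=f(c)$ if $b=a+c$ for some $c\in S$, and $(V_af)(b)=0$ otherwise. An isometric representation of $S$ is a semigroup homomorphism $a\mapsto V_a$ from $S$ into the isometries on a Hilbert space. It is faithful if $a\mapsto V_a$ is injective, non-unitary if $V_a$ is not unitary for every $a\in S$, $a\ne0$, and irreducible if the family $\{V_a,V_a^*:a\in S\}$ has no nontrivial closed invariant subspace. $\Delta_S$ denotes the set of unitary equivalence classes of faithful irreducible non-unitary isometric representations of $S$. For a representation $V$, $S_V$ denotes the multiplicative semigroup generated by the operators $V_a$ and $V_b^*$, $a,b\in S$. An inverse semigroup is a semigroup $P$ in which each element $x$ has a unique element $x^*$ with $xx^*x=x$ and $x^*xx^*=x^*$. A representation $V\in\Delta_S$ is called inverse if $S_V$ is an inverse semigroup. *)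

theory Defs
  imports "HOL-Analysis.Analysis" "HOL-Library.Function_Algebras"
begin

text \<open>
  A totally ordered abelian group is an abelian group together with a positive cone;
  the order is given by \<open>a \<le> b\<close> iff \<open>b - a\<close> lies in the cone.
\<close>

definition positive_cone :: "'g::ab_group_add set \<Rightarrow> bool" where
  "positive_cone P \<longleftrightarrow>
     (\<forall>a\<in>P. \<forall>b\<in>P. a + b \<in> P) \<and> P \<union> uminus ` P = UNIV \<and> P \<inter> uminus ` P = {0}"

lemma positive_cone_atLeast_0: "positive_cone {0::'g::linordered_ab_group_add..}"
proof -
  have "x \<in> uminus ` {0..} \<longleftrightarrow> x \<le> 0" for x :: 'g
    by (metis atLeast_iff imageE image_eqI minus_minus neg_0_le_iff_le neg_le_0_iff_le)
  then show ?thesis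
    by (auto simp: positive_cone_def)
qed


text \<open>
  Complex Hilbert spaces are carrier sets inside an ambient complex vector space, because
  \<open>\<ell>\<^sup>2(S)\<close> depends on the set \<open>S\<close>. The inner product is linear in its first argument; its
  values outside the carrier are irrelevant.
\<close>

record 'v hspace =
  hcarrier :: "'v set"
  hscale :: "complex \<Rightarrow> 'v \<Rightarrow> 'v"
  hinner :: "'v \<Rightarrow> 'v \<Rightarrow> complex"

definition hnorm :: "('v, 'm) hspace_scheme \<Rightarrow> 'v \<Rightarrow> real" where
  "hnorm H x = sqrt (Re (hinner H x x))"

definition hdist :: "('v::ab_group_add, 'm) hspace_scheme \<Rightarrow> 'v \<Rightarrow> 'v \<Rightarrow> real" where
  "hdist H x y = hnorm H (x - y)"

definition hilbert_space :: "('v::ab_group_add, 'm) hspace_scheme \<Rightarrow> bool" where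
  "hilbert_space H \<longleftrightarrow>
     vector_space (hscale H) \<and> module.subspace (hscale H) (hcarrier H) \<and>
     (\<forall>x\<in>hcarrier H. \<forall>y\<in>hcarrier H. \<forall>z\<in>hcarrier H.
        hinner H (x + y) z = hinner H x z + hinner H y z) \<and>
     (\<forall>c. \<forall>x\<in>hcarrier H. \<forall>y\<in>hcarrier H. hinner H (hscale H c x) y = c * hinner H x y) \<and>
     (\<forall>x\<in>hcarrier H. \<forall>y\<in>hcarrier H. hinner H y x = cnj (hinner H x y)) \<and>
     (\<forall>x\<in>hcarrier H. x \<noteq> 0 \<longrightarrow> Re (hinner H x x) > 0) \<and>
     Metric_space.mcomplete (hcarrier H) (hdist H)"

definition closed_subspace :: "('v::ab_group_add, 'm) hspace_scheme \<Rightarrow> 'v set \<Rightarrow> bool" where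
  "closed_subspace H M \<longleftrightarrow>
     module.subspace (hscale H) M \<and>
     closedin (Metric_space.mtopology (hcarrier H) (hdist H)) M"


text \<open>
  Operators on \<open>H\<close> are extensional functions on the carrier, so that equality of functions is
  equality of operators; accordingly, the product of operators is \<^const>\<open>compose\<close> on the
  carrier and the identity operator is \<open>\<lambda>x\<in>hcarrier H. x\<close>.
\<close>

definition bounded_operators :: "('v::ab_group_add, 'm) hspace_scheme \<Rightarrow> ('v \<Rightarrow> 'v) set" where
  "bounded_operators H =
     {T \<in> hcarrier H \<rightarrow>\<^sub>E hcarrier H.
        (\<forall>x\<in>hcarrier H. \<forall>y\<in>hcarrier H. T (x + y) = T x + T y) \<and>
        (\<forall>c. \<forall>x\<in>hcarrier H. T (hscale H c x) = hscale H c (T x)) \<and>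
        (\<exists>K. \<forall>x\<in>hcarrier H. hnorm H (T x) \<le> K * hnorm H x)}"

definition adjoint_operator :: "('v::ab_group_add, 'm) hspace_scheme \<Rightarrow> ('v \<Rightarrow> 'v) \<Rightarrow> 'v \<Rightarrow> 'v" where
  "adjoint_operator H T =
     (THE T'. T' \<in> bounded_operators H \<and>
        (\<forall>x\<in>hcarrier H. \<forall>y\<in>hcarrier H. hinner H (T x) y = hinner H x (T' y)))"

definition isometries :: "('v::ab_group_add, 'm) hspace_scheme \<Rightarrow> ('v \<Rightarrow> 'v) set" where
  "isometries H = {T \<in> bounded_operators H. \<forall>x\<in>hcarrier H. hnorm H (T x) = hnorm H x}"

definition unitary_operator :: "('v::ab_group_add, 'm) hspace_scheme \<Rightarrow> ('v \<Rightarrow> 'v) \<Rightarrow> bool" where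
  "unitary_operator H T \<longleftrightarrow>
     T \<in> bounded_operators H \<and>
     compose (hcarrier H) (adjoint_operator H T) T = (\<lambda>x\<in>hcarrier H. x) \<and>
     compose (hcarrier H) T (adjoint_operator H T) = (\<lambda>x\<in>hcarrier H. x)"


definition isometric_representation ::
  "'g::ab_group_add set \<Rightarrow> ('v::ab_group_add, 'm) hspace_scheme \<Rightarrow> ('g \<Rightarrow> 'v \<Rightarrow> 'v) \<Rightarrow> bool" where
  "isometric_representation S H V \<longleftrightarrow>
     hilbert_space H \<and> (\<forall>a\<in>S. V a \<in> isometries H) \<and>
     (\<forall>a\<in>S. \<forall>b\<in>S. V (a + b) = compose (hcarrier H) (V a) (V b))"

definition non_unitary ::
  "'g::ab_group_add set \<Rightarrow> ('v::ab_group_add, 'm) hspace_scheme \<Rightarrow> ('g \<Rightarrow> 'v \<Rightarrow> 'v) \<Rightarrow> bool" where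
  "non_unitary S H V \<longleftrightarrow> (\<forall>a\<in>S. a \<noteq> 0 \<longrightarrow> \<not> unitary_operator H (V a))"

definition irreducible_representation ::
  "'g::ab_group_add set \<Rightarrow> ('v::ab_group_add, 'm) hspace_scheme \<Rightarrow> ('g \<Rightarrow> 'v \<Rightarrow> 'v) \<Rightarrow> bool" where
  "irreducible_representation S H V \<longleftrightarrow>
     (\<forall>M. closed_subspace H M \<and>
        (\<forall>a\<in>S. V a ` M \<subseteq> M \<and> adjoint_operator H (V a) ` M \<subseteq> M)
        \<longrightarrow> M = {0} \<or> M = hcarrier H)"

text \<open>
  Membership of the unitary equivalence class of \<open>V\<close> in \<open>\<Delta>\<^sub>S\<close>, expressed on the
  representative \<open>V\<close>: all four properties are invariant under unitary equivalence.
\<close>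

definition in_Delta ::
  "'g::ab_group_add set \<Rightarrow> ('v::ab_group_add, 'm) hspace_scheme \<Rightarrow> ('g \<Rightarrow> 'v \<Rightarrow> 'v) \<Rightarrow> bool" where
  "in_Delta S H V \<longleftrightarrow>
     isometric_representation S H V \<and> inj_on V S \<and>
     irreducible_representation S H V \<and> non_unitary S H V"

inductive_set generated_semigroup ::
  "'g::ab_group_add set \<Rightarrow> ('v::ab_group_add, 'm) hspace_scheme \<Rightarrow> ('g \<Rightarrow> 'v \<Rightarrow> 'v) \<Rightarrow> ('v \<Rightarrow> 'v) set"
  for S H V where
  gen: "a \<in> S \<Longrightarrow> V a \<in> generated_semigroup S H V"
| gen_adjoint: "a \<in> S \<Longrightarrow> adjoint_operator H (V a) \<in> generated_semigroup S H V"
| mult: "X \<in> generated_semigroup S H V \<Longrightarrow> Y \<in> generated_semigroup S H V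
    \<Longrightarrow> compose (hcarrier H) X Y \<in> generated_semigroup S H V"

definition inverse_semigroup :: "'x set \<Rightarrow> ('x \<Rightarrow> 'x \<Rightarrow> 'x) \<Rightarrow> bool" where
  "inverse_semigroup P m \<longleftrightarrow>
     (\<forall>x\<in>P. \<forall>y\<in>P. m x y \<in> P) \<and>
     (\<forall>x\<in>P. \<forall>y\<in>P. \<forall>z\<in>P. m (m x y) z = m x (m y z)) \<and>
     (\<forall>x\<in>P. \<exists>!y. y \<in> P \<and> m (m x y) x = x \<and> m (m y x) y = y)"

definition inverse_representation ::
  "'g::ab_group_add set \<Rightarrow> ('v::ab_group_add, 'm) hspace_scheme \<Rightarrow> ('g \<Rightarrow> 'v \<Rightarrow> 'v) \<Rightarrow> bool" where
  "inverse_representation S H V \<longleftrightarrow>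
     in_Delta S H V \<and>
     inverse_semigroup (generated_semigroup S H V) (compose (hcarrier H))"


text \<open>
  Functions on \<open>S\<close> are represented by functions on the ambient group that vanish off \<open>S\<close>;
  the vector space structure is pointwise.
\<close>

definition l2 :: "'g set \<Rightarrow> ('g \<Rightarrow> complex) hspace" where
  "l2 S = \<lparr> hcarrier = {f. (\<forall>x. x \<notin> S \<longrightarrow> f x = 0) \<and> (\<lambda>x. (cmod (f x))\<^sup>2) summable_on S},
            hscale = (\<lambda>c f x. c * f x),
            hinner = (\<lambda>f g. \<Sum>\<^sub>\<infinity>x\<in>S. f x * cnj (g x)) \<rparr>"

text \<open>In a group, the \<open>c\<close> with \<open>b = a + c\<close> is \<open>b - a\<close>.\<close>

definition regular_representation ::
  "'g::ab_group_add set \<Rightarrow> 'g \<Rightarrow> ('g \<Rightarrow> complex) \<Rightarrow> 'g \<Rightarrow> complex" where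
  "regular_representation S a =
     (\<lambda>f\<in>hcarrier (l2 S). \<lambda>b. if \<exists>c\<in>S. b = a + c then f (b - a) else 0)"

end

theory Submission
  imports Defs
begin

text \<open>
  Write \<open>e\<^sub>a\<close> for the basis vector at \<open>a \<in> S\<close>. Then \<open>V\<^sub>a\<close> sends \<open>e\<^sub>b\<close> to \<open>e\<close> at \<open>a + b\<close>, and \<open>V\<^sub>a\<^sup>*\<close>
  undoes this and kills the basis vectors outside \<open>a + S\<close>. Both are therefore of the form
  \<open>T(g, D)\<close>: translate by a group element \<open>g\<close>, then cut down to a set \<open>D \<subseteq> S\<close> with
  \<open>D - g \<subseteq> S\<close> (\<open>partial_translation\<close>). These operators are the partial bijections
  \<open>D - g \<rightarrow> D\<close> given by translation, and they behave as such: products are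
  \<open>T(g, D) T(h, E) = T(g + h, D \<inter> (g + E))\<close>, the adjoint is \<open>T(- g, D - g)\<close>, and a nonzero
  \<open>T(g, D)\<close> determines \<open>g\<close> and \<open>D\<close>. So everything in \<open>S\<^sub>V\<close> is a partial translation, and its
  adjoint lies in \<open>S\<^sub>V\<close> again because the adjoint of a product of generators is the reversed product of
  their adjoints. The adjoint is a generalised inverse. It is the only one in \<open>S\<^sub>V\<close>: if
  \<open>T(h, E)\<close> is another generalised inverse of a nonzero \<open>T(g, D)\<close>, comparing translations
  forces \<open>h = - g\<close>, and comparing domains forces \<open>E = D - g\<close>
  (\<open>partial_translation_inverse_unique\<close>).

  The other half is that \<open>V\<close> belongs to \<open>\<Delta>\<^sub>S\<close>. Since \<open>S\<close> lies in a
  positive cone, it is pointed: \<open>a + b = 0\<close> with \<open>a, b \<in> S\<close> forces \<open>a = 0\<close>. Hence, for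
  \<open>a \<noteq> 0\<close>, the vector \<open>e\<^sub>0\<close> is orthogonal to the range of \<open>V\<^sub>a\<close>, so \<open>V\<^sub>a\<close> is not unitary. For
  irreducibility, let \<open>f\<close> be a nonzero vector of a closed invariant subspace \<open>M\<close>, say
  \<open>f b \<noteq> 0\<close>. Then \<open>g = V\<^sub>b\<^sup>* f\<close> lies in \<open>M\<close> and \<open>g 0 \<noteq> 0\<close>. The projections
  \<open>1 - V\<^sub>a V\<^sub>a\<^sup>*\<close> preserve \<open>M\<close> and erase the values on \<open>a + S\<close>; a product of them over a finite set of
  nonzero \<open>a\<close> keeps the value at \<open>0\<close>, by pointedness, and erases the value at each of these
  \<open>a\<close>, because \<open>a \<in> a + S\<close>. As the finite set grows, \<open>g 0 e\<^sub>0\<close> appears as a limit. So \<open>e\<^sub>0\<close>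
  lies in \<open>M\<close>, then so do all \<open>e\<^sub>a = V\<^sub>a e\<^sub>0\<close>, and these span a dense subspace.
\<close>

section \<open>The Hilbert space of square-summable functions\<close>

lemma mem_l2_iff:
  "f \<in> hcarrier (l2 S) \<longleftrightarrow> (\<forall>x. x \<notin> S \<longrightarrow> f x = 0) \<and> (\<lambda>x. (cmod (f x))\<^sup>2) summable_on S"
  by (simp add: l2_def)

lemma l2_scale [simp]: "hscale (l2 S) c f = (\<lambda>x. c * f x)"
  by (simp add: l2_def)

lemma l2_inner: "hinner (l2 S) f g = (\<Sum>\<^sub>\<infinity>x\<in>S. f x * cnj (g x))"
  by (simp add: l2_def)

lemma l2_inner_self: "hinner (l2 S) f f = of_real (\<Sum>\<^sub>\<infinity>x\<in>S. (cmod (f x))\<^sup>2)"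
proof -
  have "hinner (l2 S) f f = (\<Sum>\<^sub>\<infinity>x\<in>S. of_real ((cmod (f x))\<^sup>2))"
    unfolding l2_inner complex_norm_square ..
  also have "\<dots> = of_real (\<Sum>\<^sub>\<infinity>x\<in>S. (cmod (f x))\<^sup>2)"
    using summable_on_Re[of "\<lambda>x. of_real ((cmod (f x))\<^sup>2)" S]
    by (intro infsum_bounded_linear_strong bounded_linear_of_real)
       (auto simp del: of_real_power intro: summable_on_of_real)
  finally show ?thesis .
qed

lemma l2_norm: "hnorm (l2 S) f = sqrt (\<Sum>\<^sub>\<infinity>x\<in>S. (cmod (f x))\<^sup>2)"
  by (simp add: hnorm_def l2_inner_self)

lemma l2_norm_nonneg [simp]: "hnorm (l2 S) f \<ge> 0"
  by (simp add: l2_norm infsum_nonneg)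

lemma finite_L2_set_le_l2_norm:
  assumes "f \<in> hcarrier (l2 S)" "finite F" "F \<subseteq> S"
  shows "L2_set (\<lambda>x. cmod (f x)) F \<le> hnorm (l2 S) f"
  unfolding l2_norm L2_set_def
  using assms by (intro real_sqrt_le_mono finite_sum_le_infsum) (auto simp: mem_l2_iff)

lemma norm_le_l2_norm:
  assumes "f \<in> hcarrier (l2 S)"
  shows "cmod (f x) \<le> hnorm (l2 S) f"
proof (cases "x \<in> S")
  case True
  then show ?thesis
    using finite_L2_set_le_l2_norm[OF assms, of "{x}"] by simp
next
  case False
  then show ?thesis
    using assms by (simp add: mem_l2_iff)
qed

text \<open>
  Square-summability and norm estimates are reduced to uniform bounds on finite subsets, where the
  finite Minkowski inequality and pointwise limits are available. Together with
  \<open>finite_L2_set_le_l2_norm\<close> this yields both the triangle inequality and completeness.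
\<close>

lemma l2_memI_bound:
  assumes "\<And>x. x \<notin> S \<Longrightarrow> f x = 0"
    and "\<And>F. finite F \<Longrightarrow> F \<subseteq> S \<Longrightarrow> L2_set (\<lambda>x. cmod (f x)) F \<le> C"
  shows "f \<in> hcarrier (l2 S)" and "hnorm (l2 S) f \<le> C"
proof -
  have "0 \<le> C"
    using assms(2)[of "{}"] by simp
  have sums: "(\<Sum>x\<in>F. (cmod (f x))\<^sup>2) \<le> C\<^sup>2" if "finite F" "F \<subseteq> S" for F
    using assms(2)[OF that] \<open>0 \<le> C\<close> unfolding L2_set_def
    by (metis real_sqrt_le_iff real_sqrt_abs abs_of_nonneg)
  then have summable: "(\<lambda>x. (cmod (f x))\<^sup>2) summable_on S"
    by (intro nonneg_bdd_above_summable_on) (auto simp: bdd_above_def)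
  then show "f \<in> hcarrier (l2 S)"
    using assms(1) by (simp add: mem_l2_iff)
  show "hnorm (l2 S) f \<le> C"
    using infsum_le_finite_sums[OF summable sums] \<open>0 \<le> C\<close>
    by (simp add: l2_norm real_le_lsqrt)
qed

lemma l2_mem_dominated:
  assumes "g \<in> hcarrier (l2 S)" "\<And>x. cmod (f x) \<le> cmod (g x)"
  shows "f \<in> hcarrier (l2 S)"
proof -
  have "f x = 0" if "x \<notin> S" for x
    using assms(2)[of x] assms(1) that by (simp add: mem_l2_iff)
  moreover have "L2_set (\<lambda>x. cmod (f x)) F \<le> hnorm (l2 S) g" if "finite F" "F \<subseteq> S" for F
    using finite_L2_set_le_l2_norm[OF assms(1) that] L2_set_mono[of F "\<lambda>x. cmod (f x)" "\<lambda>x. cmod (g x)"]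
      assms(2) by (meson norm_ge_zero order_trans)
  ultimately show ?thesis
    by (rule l2_memI_bound)
qed

lemma l2_add:
  assumes "f \<in> hcarrier (l2 S)" "g \<in> hcarrier (l2 S)"
  shows "f + g \<in> hcarrier (l2 S)" and "hnorm (l2 S) (f + g) \<le> hnorm (l2 S) f + hnorm (l2 S) g"
proof -
  have zero: "(f + g) x = 0" if "x \<notin> S" for x
    using assms that by (simp add: mem_l2_iff)
  have bound: "L2_set (\<lambda>x. cmod ((f + g) x)) F \<le> hnorm (l2 S) f + hnorm (l2 S) g"
    if "finite F" "F \<subseteq> S" for F
  proof -
    have "L2_set (\<lambda>x. cmod ((f + g) x)) F \<le> L2_set (\<lambda>x. cmod (f x) + cmod (g x)) F"
      by (intro L2_set_mono) (auto simp: norm_triangle_ineq)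
    also have "\<dots> \<le> L2_set (\<lambda>x. cmod (f x)) F + L2_set (\<lambda>x. cmod (g x)) F"
      by (rule L2_set_triangle_ineq)
    also have "\<dots> \<le> hnorm (l2 S) f + hnorm (l2 S) g"
      using assms that by (intro add_mono finite_L2_set_le_l2_norm)
    finally show ?thesis .
  qed
  show "f + g \<in> hcarrier (l2 S)" and "hnorm (l2 S) (f + g) \<le> hnorm (l2 S) f + hnorm (l2 S) g"
    using l2_memI_bound[OF zero bound] by blast+
qed

lemma l2_zero: "0 \<in> hcarrier (l2 S)"
  by (simp add: mem_l2_iff)

lemma l2_scale_mem:
  assumes "f \<in> hcarrier (l2 S)"
  shows "(\<lambda>x. c * f x) \<in> hcarrier (l2 S)"
  using assms by (auto simp: mem_l2_iff norm_mult power_mult_distrib intro: summable_on_cmult_right)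

lemma l2_diff:
  assumes "f \<in> hcarrier (l2 S)" "g \<in> hcarrier (l2 S)"
  shows "f - g \<in> hcarrier (l2 S)"
proof -
  have "f + (\<lambda>x. (- 1) * g x) = f - g"
    by auto
  then show ?thesis
    using l2_add(1)[OF assms(1) l2_scale_mem[OF assms(2), of "- 1"]] by metis
qed

lemma vector_space_l2: "vector_space (hscale (l2 S))"
  by unfold_locales (auto simp: algebra_simps fun_eq_iff)

lemma subspace_l2_iff:
  "module.subspace (hscale (l2 S)) M \<longleftrightarrow>
     0 \<in> M \<and> (\<forall>f\<in>M. \<forall>g\<in>M. f + g \<in> M) \<and> (\<forall>c. \<forall>f\<in>M. (\<lambda>x. c * f x) \<in> M)"
proof -
  interpret vector_space "hscale (l2 S)"
    by (rule vector_space_l2)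
  show ?thesis
    by (auto simp: subspace_def)
qed

lemma summable_l2_product:
  assumes "f \<in> hcarrier (l2 S)" "g \<in> hcarrier (l2 S)"
  shows "(\<lambda>x. f x * cnj (g x)) summable_on S"
proof -
  have sum: "(\<lambda>x. (cmod (f x))\<^sup>2 + (cmod (g x))\<^sup>2) summable_on S"
    using assms by (intro summable_on_add) (auto simp: mem_l2_iff)
  have "cmod (f x * cnj (g x)) \<le> (cmod (f x))\<^sup>2 + (cmod (g x))\<^sup>2" for x
    using sum_squares_bound[of "cmod (f x)" "cmod (g x)"]
      mult_nonneg_nonneg[OF norm_ge_zero[of "f x"] norm_ge_zero[of "g x"]]
    unfolding norm_mult complex_mod_cnj by linarith
  then have "(\<lambda>x. cmod (f x * cnj (g x))) summable_on S"
    by (intro summable_on_comparison_test[OF sum]) auto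
  then show ?thesis
    by (rule abs_summable_summable)
qed

lemma Metric_space_l2: "Metric_space (hcarrier (l2 S)) (hdist (l2 S))"
proof
  fix f g :: "'a \<Rightarrow> complex"
  show "0 \<le> hdist (l2 S) f g"
    by (simp add: hdist_def)
  show "hdist (l2 S) f g = hdist (l2 S) g f"
    by (simp add: hdist_def l2_norm norm_minus_commute)
next
  fix f g assume fg: "f \<in> hcarrier (l2 S)" "g \<in> hcarrier (l2 S)"
  show "hdist (l2 S) f g = 0 \<longleftrightarrow> f = g"
  proof
    assume "hdist (l2 S) f g = 0"
    then have "cmod ((f - g) x) \<le> 0" for x
      using norm_le_l2_norm[OF l2_diff[OF fg], of x] by (simp add: hdist_def)
    then show "f = g"
      by (auto simp: fun_eq_iff)
  next
    assume "f = g"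
    then show "hdist (l2 S) f g = 0"
      by (simp add: hdist_def l2_norm)
  qed
  fix h assume h: "h \<in> hcarrier (l2 S)"
  show "hdist (l2 S) f h \<le> hdist (l2 S) f g + hdist (l2 S) g h"
    using l2_add(2)[OF l2_diff[OF fg] l2_diff[OF fg(2) h]] by (simp add: hdist_def)
qed

text \<open>
  A Cauchy sequence converges pointwise because evaluation at a point is bounded by the norm; on
  a finite set the Cauchy estimate passes to the pointwise limit, and the resulting bounds do not depend on
  the finite set.
\<close>

lemma mcomplete_l2: "Metric_space.mcomplete (hcarrier (l2 S)) (hdist (l2 S))"
proof -
  interpret Metric_space "hcarrier (l2 S)" "hdist (l2 S)"
    by (rule Metric_space_l2)
  show ?thesis
    unfolding mcomplete_def
  proof (intro allI impI)
    fix f :: "nat \<Rightarrow> 'a \<Rightarrow> complex"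
    assume "MCauchy f"
    then have f: "f n \<in> hcarrier (l2 S)" for n
      unfolding MCauchy_def image_subset_iff by blast
    have cauchy: "\<exists>N. \<forall>m\<ge>N. \<forall>n\<ge>N. hnorm (l2 S) (f m - f n) < \<epsilon>" if "\<epsilon> > 0" for \<epsilon>
    proof -
      have "\<forall>\<epsilon>>0. \<exists>N. \<forall>m n. N \<le> m \<longrightarrow> N \<le> n \<longrightarrow> hnorm (l2 S) (f m - f n) < \<epsilon>"
        using \<open>MCauchy f\<close> unfolding MCauchy_def hdist_def by (rule conjunct2)
      then show ?thesis
        using that by meson
    qed
    have "Cauchy (\<lambda>n. f n x)" for x
    proof (rule CauchyI)
      fix e :: real assume "e > 0"
      then obtain N where "\<forall>m\<ge>N. \<forall>n\<ge>N. hnorm (l2 S) (f m - f n) < e"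
        using cauchy by blast
      then show "\<exists>N. \<forall>m\<ge>N. \<forall>n\<ge>N. cmod (f m x - f n x) < e"
        using norm_le_l2_norm[OF l2_diff[OF f f], where x=x]
        by (metis minus_apply order_le_less_trans)
    qed
    then have "\<forall>x. \<exists>l. (\<lambda>n. f n x) \<longlonglongrightarrow> l"
      by (simp add: Cauchy_convergent_iff convergent_def)
    then obtain g where g: "(\<lambda>n. f n x) \<longlonglongrightarrow> g x" for x
      unfolding choice_iff by blast
    have g0: "g x = 0" if "x \<notin> S" for x
      using g[of x] f that by (simp add: mem_l2_iff LIMSEQ_const_iff)
    have tail: "\<exists>N. \<forall>n\<ge>N. f n - g \<in> hcarrier (l2 S) \<and> hnorm (l2 S) (f n - g) \<le> \<epsilon>"
      if "\<epsilon> > 0" for \<epsilon>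
    proof -
      obtain N where N: "hnorm (l2 S) (f m - f n) < \<epsilon>" if "m \<ge> N" "n \<ge> N" for m n
        using cauchy[OF \<open>\<epsilon> > 0\<close>] by blast
      have "f n - g \<in> hcarrier (l2 S) \<and> hnorm (l2 S) (f n - g) \<le> \<epsilon>" if "n \<ge> N" for n
      proof -
        have zero: "(f n - g) x = 0" if "x \<notin> S" for x
          using f[of n] g0 that by (simp add: mem_l2_iff)
        have bound: "L2_set (\<lambda>x. cmod ((f n - g) x)) F \<le> \<epsilon>" if F: "finite F" "F \<subseteq> S" for F
        proof (rule LIMSEQ_le_const2)
          show "(\<lambda>m. L2_set (\<lambda>x. cmod ((f n - f m) x)) F) \<longlonglongrightarrow> L2_set (\<lambda>x. cmod ((f n - g) x)) F"
            unfolding L2_set_def minus_apply by (intro tendsto_intros g)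
          show "\<exists>N. \<forall>m\<ge>N. L2_set (\<lambda>x. cmod ((f n - f m) x)) F \<le> \<epsilon>"
            using finite_L2_set_le_l2_norm[OF l2_diff[OF f f] F] N[OF \<open>n \<ge> N\<close>]
            by (meson order_trans order_less_imp_le)
        qed
        show ?thesis
          using l2_memI_bound[OF zero bound] by blast
      qed
      then show ?thesis
        by blast
    qed
    \<comment> \<open>The limit is a member of the sequence minus a square-summable error.\<close>
    have "g \<in> hcarrier (l2 S)"
    proof -
      obtain n where "f n - g \<in> hcarrier (l2 S)"
        using tail[of 1] by auto
      then have "f n - (f n - g) \<in> hcarrier (l2 S)"
        using f l2_diff by blast
      then show ?thesis
        by simp
    qed
    moreover have "\<exists>N. \<forall>n\<ge>N. hdist (l2 S) (f n) g < \<epsilon>" if "\<epsilon> > 0" for \<epsilon>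
      using tail[of "\<epsilon> / 2"] that unfolding hdist_def by (smt (verit) field_sum_of_halves)
    ultimately show "\<exists>g. limitin mtopology f g sequentially"
      using f by (auto simp: limit_metric_sequentially)
  qed
qed

theorem hilbert_space_l2: "hilbert_space (l2 S)"
  unfolding hilbert_space_def
proof (intro conjI ballI allI impI)
  show "vector_space (hscale (l2 S))"
    by (rule vector_space_l2)
  show "module.subspace (hscale (l2 S)) (hcarrier (l2 S))"
    unfolding subspace_l2_iff
    using l2_add(1) l2_scale_mem by (auto simp only: l2_zero)
  show "Metric_space.mcomplete (hcarrier (l2 S)) (hdist (l2 S))"
    by (rule mcomplete_l2)
next
  fix f g h assume fg: "f \<in> hcarrier (l2 S)" "g \<in> hcarrier (l2 S)" and h: "h \<in> hcarrier (l2 S)"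
  show "hinner (l2 S) (f + g) h = hinner (l2 S) f h + hinner (l2 S) g h"
    using infsum_add[OF summable_l2_product[OF fg(1) h] summable_l2_product[OF fg(2) h]]
    by (simp add: l2_inner algebra_simps)
next
  fix f g c assume "f \<in> hcarrier (l2 S)" "g \<in> hcarrier (l2 S)"
  show "hinner (l2 S) (hscale (l2 S) c f) g = c * hinner (l2 S) f g"
    by (simp add: l2_inner infsum_cmult_right' mult.assoc)
  show "hinner (l2 S) g f = cnj (hinner (l2 S) f g)"
    by (simp add: l2_inner mult.commute flip: infsum_cnj)
next
  fix f assume f: "f \<in> hcarrier (l2 S)" "f \<noteq> 0"
  then obtain x where "f x \<noteq> 0"
    by (auto simp: fun_eq_iff)
  then have "0 < hnorm (l2 S) f"
    using norm_le_l2_norm[OF f(1), of x] by (metis order_less_le_trans zero_less_norm_iff)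
  then show "Re (hinner (l2 S) f f) > 0"
    by (simp add: hnorm_def)
qed

section \<open>Basis vectors and closed subspaces\<close>

definition basis_vector :: "'g \<Rightarrow> 'g \<Rightarrow> complex" where
  "basis_vector a = (\<lambda>b. if b = a then 1 else 0)"

lemma basis_vector_mem: "a \<in> S \<Longrightarrow> basis_vector a \<in> hcarrier (l2 S)"
proof -
  assume "a \<in> S"
  then have "(\<lambda>x. (cmod (basis_vector a x))\<^sup>2) summable_on S \<longleftrightarrow>
      (\<lambda>x. (cmod (basis_vector a x))\<^sup>2) summable_on {a}"
    by (intro summable_on_cong_neutral) (auto simp: basis_vector_def)
  with \<open>a \<in> S\<close> show ?thesis
    by (auto simp: mem_l2_iff basis_vector_def)
qed

lemma l2_inner_basis_vector:
  assumes "a \<in> S"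
  shows "hinner (l2 S) (basis_vector a) f = cnj (f a)"
proof -
  have "hinner (l2 S) (basis_vector a) f = (\<Sum>\<^sub>\<infinity>x\<in>{a}. basis_vector a x * cnj (f x))"
    unfolding l2_inner using assms by (intro infsum_cong_neutral) (auto simp: basis_vector_def)
  then show ?thesis
    by (simp add: basis_vector_def)
qed

text \<open>
  Stated for every function dominated by \<open>f\<close>, so that it serves both to approximate \<open>f\<close> by
  finitely supported functions and to control a function that has been set to zero on further points.
\<close>

lemma l2_tail:
  assumes f: "f \<in> hcarrier (l2 S)" and "\<epsilon> > 0"
  shows "\<exists>F. finite F \<and> F \<subseteq> S \<and>
    (\<forall>h. (\<forall>x. cmod (h x) \<le> cmod (f x)) \<and> (\<forall>x\<in>F. h x = 0) \<longrightarrow> hnorm (l2 S) h < \<epsilon>)"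
proof -
  let ?p = "\<lambda>x. (cmod (f x))\<^sup>2"
  have summable: "?p summable_on S"
    using f by (simp add: mem_l2_iff)
  \<comment> \<open>Half of the squared tolerance leaves room for the strict inequality.\<close>
  then obtain F where F: "finite F" "F \<subseteq> S" and close: "dist (sum ?p F) (infsum ?p S) \<le> \<epsilon>\<^sup>2 / 2"
    using infsum_finite_approximation[of ?p S "\<epsilon>\<^sup>2 / 2"] \<open>\<epsilon> > 0\<close> by auto
  have "hnorm (l2 S) h < \<epsilon>" if h: "\<forall>x. cmod (h x) \<le> cmod (f x)" "\<forall>x\<in>F. h x = 0" for h
  proof -
    have "h \<in> hcarrier (l2 S)"
      using l2_mem_dominated[OF f] h(1) by blast
    then have h_summable: "(\<lambda>x. (cmod (h x))\<^sup>2) summable_on S"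
      by (simp add: mem_l2_iff)
    have "infsum (\<lambda>x. (cmod (h x))\<^sup>2) S \<le> \<epsilon>\<^sup>2 / 2"
    proof (rule infsum_le_finite_sums[OF h_summable])
      fix G assume G: "finite G" "G \<subseteq> S"
      have "(\<Sum>x\<in>G. (cmod (h x))\<^sup>2) = (\<Sum>x\<in>G - F. (cmod (h x))\<^sup>2)"
        using h(2) G by (intro sum.mono_neutral_right) auto
      also have "\<dots> \<le> sum ?p (G - F)"
        using h(1) by (intro sum_mono power_mono) auto
      also have "\<dots> = sum ?p ((G - F) \<union> F) - sum ?p F"
        using F G by (subst sum.union_disjoint) auto
      also have "sum ?p ((G - F) \<union> F) \<le> infsum ?p S"
        using F G summable by (intro finite_sum_le_infsum) auto
      finally show "(\<Sum>x\<in>G. (cmod (h x))\<^sup>2) \<le> \<epsilon>\<^sup>2 / 2"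
        using close unfolding dist_real_def by linarith
    qed
    also have "\<epsilon>\<^sup>2 / 2 < \<epsilon>\<^sup>2"
      using \<open>\<epsilon> > 0\<close> by simp
    finally show ?thesis
      using \<open>\<epsilon> > 0\<close> unfolding l2_norm by (intro real_less_lsqrt) auto
  qed
  with F show ?thesis
    by blast
qed

lemma closed_subspace_l2D:
  assumes "closed_subspace (l2 S) M"
  shows "M \<subseteq> hcarrier (l2 S)" "0 \<in> M"
    and "\<And>f g. f \<in> M \<Longrightarrow> g \<in> M \<Longrightarrow> f + g \<in> M" "\<And>c f. f \<in> M \<Longrightarrow> (\<lambda>x. c * f x) \<in> M"
    and "\<And>f g. f \<in> M \<Longrightarrow> g \<in> M \<Longrightarrow> f - g \<in> M"
proof -
  interpret Metric_space "hcarrier (l2 S)" "hdist (l2 S)"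
    by (rule Metric_space_l2)
  show "M \<subseteq> hcarrier (l2 S)"
    using assms by (simp add: closed_subspace_def closedin_metric)
  show "0 \<in> M"
    using assms by (simp add: closed_subspace_def subspace_l2_iff)
  show add: "f + g \<in> M" if "f \<in> M" "g \<in> M" for f g
    using assms that by (simp add: closed_subspace_def subspace_l2_iff)
  show scale: "(\<lambda>x. c * f x) \<in> M" if "f \<in> M" for c f
    using assms that by (simp add: closed_subspace_def subspace_l2_iff)
  have "f + (\<lambda>x. (- 1) * g x) = f - g" for f g :: "'a \<Rightarrow> complex"
    by auto
  then show "f - g \<in> M" if "f \<in> M" "g \<in> M" for f g
    using add[OF that(1) scale[OF that(2), of "- 1"]] by metis
qed

lemma closed_subspace_l2_limit:
  assumes "closed_subspace (l2 S) M" "f \<in> hcarrier (l2 S)"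
    and approx: "\<And>\<epsilon>. \<epsilon> > 0 \<Longrightarrow> \<exists>h\<in>M. hnorm (l2 S) (f - h) < \<epsilon>"
  shows "f \<in> M"
proof (rule ccontr)
  interpret Metric_space "hcarrier (l2 S)" "hdist (l2 S)"
    by (rule Metric_space_l2)
  assume "f \<notin> M"
  then obtain r where "r > 0" and disj: "disjnt M (mball f r)"
    using assms(1,2) by (auto simp: closed_subspace_def closedin_metric)
  then obtain h where "h \<in> M" "hnorm (l2 S) (f - h) < r"
    using approx by blast
  then have "h \<in> M \<inter> mball f r"
    using assms(2) closed_subspace_l2D(1)[OF assms(1)] by (auto simp: hdist_def)
  with disj show False
    by (auto simp: disjnt_def)
qed

lemma closed_subspace_l2_eq_carrier:
  assumes M: "closed_subspace (l2 S) M" and basis: "\<And>a. a \<in> S \<Longrightarrow> basis_vector a \<in> M"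
  shows "M = hcarrier (l2 S)"
proof (rule antisym)
  show "M \<subseteq> hcarrier (l2 S)"
    using M by (rule closed_subspace_l2D)
  show "hcarrier (l2 S) \<subseteq> M"
  proof
    fix f assume f: "f \<in> hcarrier (l2 S)"
    have finite: "(\<lambda>x. if x \<in> F then f x else 0) \<in> M" if "finite F" "F \<subseteq> S" for F
      using that
    proof (induction F rule: finite_induct)
      case empty
      then show ?case
        using closed_subspace_l2D(2)[OF M] by (simp add: zero_fun_def)
    next
      case (insert a F)
      have "(\<lambda>x. if x \<in> insert a F then f x else 0) =
          (\<lambda>x. if x \<in> F then f x else 0) + (\<lambda>x. f a * basis_vector a x)"
        using insert.hyps by (auto simp: basis_vector_def)
      also have "\<dots> \<in> M"
        using insert by (intro closed_subspace_l2D(3)[OF M] closed_subspace_l2D(4)[OF M] basis) auto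
      finally show ?case .
    qed
    show "f \<in> M"
    proof (rule closed_subspace_l2_limit[OF M f])
      fix \<epsilon> :: real assume "\<epsilon> > 0"
      obtain F where "finite F" "F \<subseteq> S" and tail:
        "\<And>h. \<lbrakk>\<forall>x. cmod (h x) \<le> cmod (f x); \<forall>x\<in>F. h x = 0\<rbrakk> \<Longrightarrow> hnorm (l2 S) h < \<epsilon>"
        using l2_tail[OF f \<open>\<epsilon> > 0\<close>] by blast
      have "hnorm (l2 S) (f - (\<lambda>x. if x \<in> F then f x else 0)) < \<epsilon>"
        by (rule tail) auto
      with finite[OF \<open>finite F\<close> \<open>F \<subseteq> S\<close>] show "\<exists>h\<in>M. hnorm (l2 S) (f - h) < \<epsilon>"
        by blast
    qed
  qed
qed

section \<open>Partial translations\<close>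

text \<open>
  On basis vectors this is the partial bijection \<open>D - g \<rightarrow> D\<close>, \<open>c \<mapsto> c + g\<close>: the set \<open>D\<close> is the
  range and not the domain, which is the convenient choice because the value at \<open>b\<close> of the
  image function is decided by whether \<open>b \<in> D\<close>.
\<close>

definition partial_translation ::
  "'g::ab_group_add set \<Rightarrow> 'g \<Rightarrow> 'g set \<Rightarrow> ('g \<Rightarrow> complex) \<Rightarrow> 'g \<Rightarrow> complex" where
  "partial_translation S g D = (\<lambda>f\<in>hcarrier (l2 S). \<lambda>b. if b \<in> D then f (b - g) else 0)"

definition translatable :: "'g::ab_group_add set \<Rightarrow> 'g \<Rightarrow> 'g set \<Rightarrow> bool" where
  "translatable S g D \<longleftrightarrow> D \<subseteq> S \<and> (\<lambda>b. b - g) ` D \<subseteq> S"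

text \<open>
  The substitution \<open>c = b - g\<close> turns the sum over the range into the sum over the domain.
\<close>

lemma translate_mem:
  assumes "translatable S g D" "f \<in> hcarrier (l2 S)"
  shows "(\<lambda>b. if b \<in> D then f (b - g) else 0) \<in> hcarrier (l2 S)" (is "?f \<in> _")
    and "(\<Sum>\<^sub>\<infinity>b\<in>S. (cmod (if b \<in> D then f (b - g) else 0))\<^sup>2) =
         (\<Sum>\<^sub>\<infinity>c\<in>(\<lambda>b. b - g) ` D. (cmod (f c))\<^sup>2)"
proof -
  have inj: "inj_on (\<lambda>b. b - g) D"
    by (simp add: inj_on_def)
  have D: "D \<subseteq> S" "(\<lambda>b. b - g) ` D \<subseteq> S"
    using assms(1) by (auto simp: translatable_def)
  have "(\<lambda>c. (cmod (f c))\<^sup>2) summable_on (\<lambda>b. b - g) ` D"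
    using assms(2) D(2) by (auto simp: mem_l2_iff intro: summable_on_subset_banach)
  then have "(\<lambda>b. (cmod (f (b - g)))\<^sup>2) summable_on D"
    by (simp add: summable_on_reindex[OF inj] o_def)
  moreover have "(\<lambda>b. (cmod (?f b))\<^sup>2) summable_on S \<longleftrightarrow> (\<lambda>b. (cmod (f (b - g)))\<^sup>2) summable_on D"
    using D by (intro summable_on_cong_neutral) auto
  ultimately show "?f \<in> hcarrier (l2 S)"
    using D by (auto simp: mem_l2_iff)
  have "(\<Sum>\<^sub>\<infinity>b\<in>S. (cmod (?f b))\<^sup>2) = (\<Sum>\<^sub>\<infinity>b\<in>D. (cmod (f (b - g)))\<^sup>2)"
    using D by (intro infsum_cong_neutral) auto
  also have "\<dots> = (\<Sum>\<^sub>\<infinity>c\<in>(\<lambda>b. b - g) ` D. (cmod (f c))\<^sup>2)"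
    by (simp add: infsum_reindex[OF inj] o_def)
  finally show "(\<Sum>\<^sub>\<infinity>b\<in>S. (cmod (?f b))\<^sup>2) = (\<Sum>\<^sub>\<infinity>c\<in>(\<lambda>b. b - g) ` D. (cmod (f c))\<^sup>2)" .
qed

lemma partial_translation_mem:
  assumes "translatable S g D" "f \<in> hcarrier (l2 S)"
  shows "partial_translation S g D f \<in> hcarrier (l2 S)"
  using translate_mem(1)[OF assms] assms(2) by (simp add: partial_translation_def)

lemma partial_translation_apply:
  assumes "f \<in> hcarrier (l2 S)"
  shows "partial_translation S g D f b = (if b \<in> D then f (b - g) else 0)"
  using assms by (simp add: partial_translation_def)

lemma partial_translation_bounded:
  assumes "translatable S g D"
  shows "partial_translation S g D \<in> bounded_operators (l2 S)"
proof -
  let ?H = "hcarrier (l2 S)" and ?T = "partial_translation S g D"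
  have "hnorm (l2 S) (?T f) \<le> 1 * hnorm (l2 S) f" if f: "f \<in> ?H" for f
  proof -
    have "(\<Sum>\<^sub>\<infinity>b\<in>S. (cmod (?T f b))\<^sup>2) = (\<Sum>\<^sub>\<infinity>c\<in>(\<lambda>b. b - g) ` D. (cmod (f c))\<^sup>2)"
      using translate_mem(2)[OF assms f] by (simp only: partial_translation_apply[OF f])
    also have "\<dots> \<le> (\<Sum>\<^sub>\<infinity>c\<in>S. (cmod (f c))\<^sup>2)"
      using f assms
      by (intro infsum_mono2) (auto simp: mem_l2_iff translatable_def intro: summable_on_subset_banach)
    finally show ?thesis
      by (simp add: l2_norm)
  qed
  moreover have "?T (f + h) = ?T f + ?T h" if "f \<in> ?H" "h \<in> ?H" for f h
    using that l2_add(1)[OF that] by (auto simp: partial_translation_def)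
  moreover have "?T (hscale (l2 S) c f) = hscale (l2 S) c (?T f)" if "f \<in> ?H" for c f
    using that l2_scale_mem[OF that, of c] by (auto simp: partial_translation_def)
  moreover have "?T \<in> ?H \<rightarrow>\<^sub>E ?H"
    using partial_translation_mem[OF assms] by (auto simp: partial_translation_def)
  ultimately show ?thesis
    unfolding bounded_operators_def by blast
qed

lemma partial_translation_isometry:
  assumes "translatable S g D" "(\<lambda>b. b - g) ` D = S"
  shows "partial_translation S g D \<in> isometries (l2 S)"
  unfolding isometries_def
proof (intro CollectI conjI ballI)
  show "partial_translation S g D \<in> bounded_operators (l2 S)"
    using assms(1) by (rule partial_translation_bounded)
  fix f assume f: "f \<in> hcarrier (l2 S)"
  show "hnorm (l2 S) (partial_translation S g D f) = hnorm (l2 S) f"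
    using translate_mem(2)[OF assms(1) f] assms(2) by (simp add: l2_norm partial_translation_apply[OF f])
qed

lemma translatable_adjoint:
  "translatable S g D \<Longrightarrow> translatable S (- g) ((\<lambda>b. b - g) ` D)"
  by (auto simp: translatable_def)

text \<open>
  The adjoint of a partial bijection is its inverse, by the same substitution in the inner product.
  An operator is determined by its matrix coefficients against basis vectors, hence
  the uniqueness demanded by the definite description.
\<close>

lemma adjoint_partial_translation:
  assumes "translatable S g D"
  shows "adjoint_operator (l2 S) (partial_translation S g D) =
         partial_translation S (- g) ((\<lambda>b. b - g) ` D)"
  unfolding adjoint_operator_def
proof (rule the_equality)
  let ?H = "hcarrier (l2 S)" and ?T = "partial_translation S g D"
  let ?T' = "partial_translation S (- g) ((\<lambda>b. b - g) ` D)"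
  have adjoint: "hinner (l2 S) (?T f) h = hinner (l2 S) f (?T' h)" if f: "f \<in> ?H" and h: "h \<in> ?H" for f h
  proof -
    have inj: "inj_on (\<lambda>b. b - g) D"
      by (simp add: inj_on_def)
    have "hinner (l2 S) (?T f) h = (\<Sum>\<^sub>\<infinity>b\<in>D. f (b - g) * cnj (h b))"
      unfolding l2_inner using assms
      by (intro infsum_cong_neutral) (auto simp: partial_translation_apply[OF f] translatable_def)
    also have "\<dots> = (\<Sum>\<^sub>\<infinity>c\<in>(\<lambda>b. b - g) ` D. f c * cnj (h (c + g)))"
      by (simp add: infsum_reindex[OF inj] o_def)
    also have "\<dots> = hinner (l2 S) f (?T' h)"
      unfolding l2_inner using assms
      by (intro infsum_cong_neutral) (auto simp: partial_translation_apply[OF h] translatable_def)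
    finally show ?thesis .
  qed
  show "?T' \<in> bounded_operators (l2 S) \<and>
      (\<forall>f\<in>?H. \<forall>h\<in>?H. hinner (l2 S) (?T f) h = hinner (l2 S) f (?T' h))"
    using adjoint partial_translation_bounded[OF translatable_adjoint[OF assms]] by blast
  fix U assume U: "U \<in> bounded_operators (l2 S) \<and>
      (\<forall>f\<in>?H. \<forall>h\<in>?H. hinner (l2 S) (?T f) h = hinner (l2 S) f (U h))"
  have "U h = ?T' h" if h: "h \<in> ?H" for h
  proof
    fix x
    show "U h x = ?T' h x"
    proof (cases "x \<in> S")
      case True
      have "hinner (l2 S) (basis_vector x) (U h) = hinner (l2 S) (basis_vector x) (?T' h)"
        using U adjoint h basis_vector_mem[OF True] by metis
      then show ?thesis
        by (simp add: l2_inner_basis_vector[OF True])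
    next
      case False
      have "U h \<in> ?H"
        using U h by (auto simp: bounded_operators_def)
      with False partial_translation_mem[OF translatable_adjoint[OF assms] h] show ?thesis
        by (simp add: mem_l2_iff)
    qed
  qed
  moreover have "U \<in> extensional ?H" "?T' \<in> extensional ?H"
    using U by (auto simp: bounded_operators_def partial_translation_def PiE_def)
  ultimately show "U = ?T'"
    by (rule extensionalityI[rotated 2])
qed

lemma compose_partial_translation:
  assumes "translatable S h E"
  shows "compose (hcarrier (l2 S)) (partial_translation S g D) (partial_translation S h E) =
         partial_translation S (g + h) {b \<in> D. b - g \<in> E}"
  using partial_translation_mem[OF assms]
  by (auto simp: compose_def fun_eq_iff partial_translation_apply diff_diff_eq)
     (auto simp: partial_translation_def)

lemma translatable_compose:
  assumes "translatable S g D" "translatable S h E"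
  shows "translatable S (g + h) {b \<in> D. b - g \<in> E}"
  using assms by (auto simp: translatable_def diff_diff_eq[symmetric])

text \<open>
  The image of one basis vector with index in \<open>D - g\<close> reveals \<open>g\<close>. The translation is lost
  exactly for the zero operator, which has \<open>D = {}\<close>.
\<close>

lemma partial_translation_eq_iff:
  assumes "translatable S g D" "translatable S h E"
  shows "partial_translation S g D = partial_translation S h E \<longleftrightarrow> D = E \<and> (D = {} \<or> g = h)"
proof
  assume eq: "partial_translation S g D = partial_translation S h E"
  have main: "b \<in> E' \<and> g' = h'"
    if tr: "translatable S g' D'" and eq': "partial_translation S g' D' = partial_translation S h' E'"
      and "b \<in> D'" for g' h' D' E' b
  proof -
    have mem: "basis_vector (b - g') \<in> hcarrier (l2 S)"
      using tr \<open>b \<in> D'\<close> by (intro basis_vector_mem) (auto simp: translatable_def)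
    have "partial_translation S g' D' (basis_vector (b - g')) b = 1"
      using \<open>b \<in> D'\<close> by (simp add: partial_translation_apply[OF mem]) (simp add: basis_vector_def)
    then have "partial_translation S h' E' (basis_vector (b - g')) b = 1"
      by (simp only: eq')
    then show ?thesis
      unfolding partial_translation_apply[OF mem] by (auto simp: basis_vector_def split: if_splits)
  qed
  show "D = E \<and> (D = {} \<or> g = h)"
    using main[OF assms(1) eq] main[OF assms(2) eq[symmetric]] by blast
next
  assume "D = E \<and> (D = {} \<or> g = h)"
  then show "partial_translation S g D = partial_translation S h E"
    by (auto simp: partial_translation_def)
qed

lemma partial_translation_inverse:
  assumes "translatable S g D"
  shows "compose (hcarrier (l2 S)) (compose (hcarrier (l2 S)) (partial_translation S g D)
           (partial_translation S (- g) ((\<lambda>b. b - g) ` D))) (partial_translation S g D) =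
         partial_translation S g D"
proof -
  have "{b \<in> D. b - g \<in> (\<lambda>b. b - g) ` D} = D"
    by auto
  then show ?thesis
    using assms translatable_adjoint[OF assms]
    by (simp add: compose_partial_translation)
qed

text \<open>
  A partial translation whose set is nonempty has a well-defined translation part, and
  the first equation compares \<open>g + h + g\<close> with \<open>g\<close>; after that the two equations are inclusions between
  \<open>E\<close> and \<open>D - g\<close>. If \<open>D\<close> is empty, then the second equation makes both operators zero.
\<close>

lemma partial_translation_inverse_unique:
  assumes x: "translatable S g D" and y: "translatable S h E"
    and xyx: "compose (hcarrier (l2 S)) (compose (hcarrier (l2 S)) (partial_translation S g D)
        (partial_translation S h E)) (partial_translation S g D) = partial_translation S g D"
    and yxy: "compose (hcarrier (l2 S)) (compose (hcarrier (l2 S)) (partial_translation S h E)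
        (partial_translation S g D)) (partial_translation S h E) = partial_translation S h E"
  shows "partial_translation S h E = partial_translation S (- g) ((\<lambda>b. b - g) ` D)"
proof -
  have eq1: "{b \<in> D. b - g \<in> E \<and> b - (g + h) \<in> D} = D" "D = {} \<or> g + h + g = g"
    using xyx x y translatable_compose[OF translatable_compose[OF x y] x]
    by (auto simp: compose_partial_translation partial_translation_eq_iff)
  have eq2: "{b \<in> E. b - h \<in> D \<and> b - (h + g) \<in> E} = E"
    using yxy x y translatable_compose[OF translatable_compose[OF y x] y]
    by (auto simp: compose_partial_translation partial_translation_eq_iff)
  show ?thesis
  proof (cases "D = {}")
    case True
    then have "E = {}"
      using eq2 by blast
    with True show ?thesis
      by (simp add: partial_translation_def)
  next
    case False
    then have h: "h = - g"
      using eq1(2) by (simp add: add_eq_0_iff)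
    have "E = (\<lambda>b. b - g) ` D"
    proof
      show "(\<lambda>b. b - g) ` D \<subseteq> E"
        using eq1(1) by blast
      show "E \<subseteq> (\<lambda>b. b - g) ` D"
      proof
        fix e assume "e \<in> E"
        then have "e + g \<in> D"
          using eq2 h by auto
        then show "e \<in> (\<lambda>b. b - g) ` D"
          by (rule rev_image_eqI) simp
      qed
    qed
    with h show ?thesis
      by simp
  qed
qed

section \<open>The regular representation belongs to \<open>\<Delta>\<^sub>S\<close>\<close>

text \<open>
  The last condition is how the positive cone acts on \<open>S\<close>: it says \<open>S \<inter> (- S) = {0}\<close>.
\<close>

locale pointed_submonoid =
  fixes S :: "'g::ab_group_add set"
  assumes zero_mem: "0 \<in> S"
    and add_mem: "a \<in> S \<Longrightarrow> b \<in> S \<Longrightarrow> a + b \<in> S"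
    and add_eq_0D: "a \<in> S \<Longrightarrow> b \<in> S \<Longrightarrow> a + b = 0 \<Longrightarrow> a = 0"
begin

abbreviation V where "V \<equiv> regular_representation S"

lemma mem_add_image_iff: "x \<in> (+) a ` S \<longleftrightarrow> x - a \<in> S"
  by (auto simp: image_iff) (metis add.commute diff_add_cancel)

lemma regular_representation_eq:
  "V a = partial_translation S a ((+) a ` S)"
  by (auto simp: regular_representation_def partial_translation_def image_iff Bex_def)

lemma regular_translatable: "a \<in> S \<Longrightarrow> translatable S a ((+) a ` S)"
  using add_mem by (auto simp: translatable_def)

lemma adjoint_regular_representation:
  assumes "a \<in> S"
  shows "adjoint_operator (l2 S) (V a) = partial_translation S (- a) S"
  using adjoint_partial_translation[OF regular_translatable[OF assms]]
  by (simp add: regular_representation_eq image_image)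

lemma regular_representation_apply:
  "f \<in> hcarrier (l2 S) \<Longrightarrow> V a f x = (if x - a \<in> S then f (x - a) else 0)"
  by (simp add: regular_representation_eq partial_translation_apply mem_add_image_iff)

lemma adjoint_regular_representation_apply:
  "a \<in> S \<Longrightarrow> f \<in> hcarrier (l2 S) \<Longrightarrow>
     adjoint_operator (l2 S) (V a) f x = (if x \<in> S then f (x + a) else 0)"
  by (simp add: adjoint_regular_representation partial_translation_apply)

lemma adjoint_regular_representation_mem:
  "a \<in> S \<Longrightarrow> f \<in> hcarrier (l2 S) \<Longrightarrow> adjoint_operator (l2 S) (V a) f \<in> hcarrier (l2 S)"
  using add_mem
  by (simp add: adjoint_regular_representation partial_translation_mem translatable_def image_subset_iff)

lemma regular_representation_basis_vector:
  assumes "b \<in> S"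
  shows "V a (basis_vector b) = basis_vector (a + b)"
  using assms
  by (auto simp: fun_eq_iff regular_representation_apply basis_vector_mem)
     (auto simp: basis_vector_def)

lemma isometric_regular_representation: "isometric_representation S (l2 S) V"
  unfolding isometric_representation_def
proof (intro conjI ballI)
  show "hilbert_space (l2 S)"
    by (rule hilbert_space_l2)
  show "V a \<in> isometries (l2 S)" if "a \<in> S" for a
    unfolding regular_representation_eq
    using regular_translatable[OF that] by (rule partial_translation_isometry) (simp add: image_image)
  show "V (a + b) = compose (hcarrier (l2 S)) (V a) (V b)" if "a \<in> S" "b \<in> S" for a b
  proof -
    have "(+) (a + b) ` S = {x \<in> (+) a ` S. x - a \<in> (+) b ` S}"
      using add_mem[OF that(2)]
      by (auto simp: mem_add_image_iff diff_diff_eq)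
    then show ?thesis
      by (simp add: regular_representation_eq compose_partial_translation regular_translatable that)
  qed
qed

lemma inj_regular_representation: "inj_on V S"
proof (rule inj_onI)
  fix a b assume ab: "a \<in> S" "b \<in> S" and "V a = V b"
  then have "partial_translation S a ((+) a ` S) = partial_translation S b ((+) b ` S)"
    by (simp add: regular_representation_eq)
  then show "a = b"
    using partial_translation_eq_iff[OF ab[THEN regular_translatable]] zero_mem by auto
qed

text \<open>
  The vector at \<open>0\<close> is not in the range of an isometry with \<open>a \<noteq> 0\<close>: the value at \<open>0\<close> of anything
  in that range is a value at \<open>- a\<close>, and \<open>- a \<notin> S\<close>.
\<close>

lemma non_unitary_regular_representation: "non_unitary S (l2 S) V"
  unfolding non_unitary_def
proof (intro ballI impI notI)
  fix a assume a: "a \<in> S" "a \<noteq> 0" and "unitary_operator (l2 S) (V a)"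
  then have id: "compose (hcarrier (l2 S)) (V a) (adjoint_operator (l2 S) (V a)) =
      (\<lambda>f\<in>hcarrier (l2 S). f)"
    by (simp add: unitary_operator_def)
  have "compose (hcarrier (l2 S)) (V a) (adjoint_operator (l2 S) (V a)) (basis_vector 0) 0 = 1"
    unfolding id using basis_vector_mem[OF zero_mem] by simp (simp add: basis_vector_def)
  moreover have "- a \<notin> S"
    using add_eq_0D[OF a(1), of "- a"] a(2) by auto
  ultimately show False
    using basis_vector_mem[OF zero_mem] a(1)
    by (simp add: compose_def regular_representation_apply adjoint_regular_representation_mem)
qed

text \<open>
  Multiplication by the indicator of \<open>a + S\<close> is \<open>V\<^sub>a V\<^sub>a\<^sup>*\<close>, so the restriction to
  the complement of finitely many translates is a finite product of operators \<open>1 - V\<^sub>a V\<^sub>a\<^sup>*\<close>.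
\<close>

lemma restrict_outside_translates_mem:
  assumes M: "closed_subspace (l2 S) M"
    and inv: "\<And>a. a \<in> S \<Longrightarrow> V a ` M \<subseteq> M" "\<And>a. a \<in> S \<Longrightarrow> adjoint_operator (l2 S) (V a) ` M \<subseteq> M"
    and "f \<in> M" "finite F" "F \<subseteq> S"
  shows "(\<lambda>x. if \<exists>a\<in>F. x - a \<in> S then 0 else f x) \<in> M"
  using \<open>finite F\<close> \<open>F \<subseteq> S\<close>
proof (induction F rule: finite_induct)
  case empty
  then show ?case
    using \<open>f \<in> M\<close> by simp
next
  case (insert a F)
  let ?h = "\<lambda>x. if \<exists>a\<in>F. x - a \<in> S then 0 else f x"
  have h: "?h \<in> M" and a: "a \<in> S"
    using insert by auto
  let ?k = "V a (adjoint_operator (l2 S) (V a) ?h)"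
  have "?h \<in> hcarrier (l2 S)"
    using h closed_subspace_l2D(1)[OF M] by blast
  then have k: "?k x = (if x - a \<in> S then ?h x else 0)" for x
    using a by (simp add: regular_representation_apply adjoint_regular_representation_apply
        adjoint_regular_representation_mem)
  have "?k \<in> M"
    using h inv[OF a] by blast
  then have "?h - ?k \<in> M"
    using closed_subspace_l2D(5)[OF M h] by blast
  also have "?h - ?k = (\<lambda>x. if \<exists>a\<in>insert a F. x - a \<in> S then 0 else f x)"
    by (auto simp: k)
  finally show ?case .
qed

text \<open>
  A nonzero invariant subspace contains a vector with nonzero value at \<open>0\<close>; erasing more and more
  translates \<open>a + S\<close> with \<open>a \<noteq> 0\<close> isolates that value and produces the cyclic vector at \<open>0\<close>.
\<close>

lemma irreducible_regular_representation: "irreducible_representation S (l2 S) V"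
  unfolding irreducible_representation_def
proof (intro allI impI, elim conjE)
  fix M
  assume M: "closed_subspace (l2 S) M"
    and "\<forall>a\<in>S. V a ` M \<subseteq> M \<and> adjoint_operator (l2 S) (V a) ` M \<subseteq> M"
  then have inv: "V a ` M \<subseteq> M" "adjoint_operator (l2 S) (V a) ` M \<subseteq> M" if "a \<in> S" for a
    using that by blast+
  note MD = closed_subspace_l2D[OF M]
  show "M = {0} \<or> M = hcarrier (l2 S)"
  proof (rule disjCI)
    assume "M \<noteq> hcarrier (l2 S)"
    show "M = {0}"
    proof (rule ccontr)
      assume "M \<noteq> {0}"
      then obtain f where f: "f \<in> M" "f \<noteq> 0"
        using MD(2) by blast
      then obtain b where b: "f b \<noteq> 0"
        by (auto simp: fun_eq_iff)
      have "f \<in> hcarrier (l2 S)"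
        using f(1) MD(1) by blast
      with b have "b \<in> S"
        by (auto simp: mem_l2_iff)
      define g where "g = adjoint_operator (l2 S) (V b) f"
      have "g \<in> M"
        unfolding g_def using f inv(2)[OF \<open>b \<in> S\<close>] by blast
      then have g: "g \<in> hcarrier (l2 S)"
        using MD(1) by blast
      have "g 0 \<noteq> 0"
        unfolding g_def using f b MD(1) \<open>b \<in> S\<close> zero_mem
        by (subst adjoint_regular_representation_apply) auto
      let ?e = "\<lambda>x. g 0 * basis_vector 0 x"
      have "?e \<in> M"
      proof (rule closed_subspace_l2_limit[OF M])
        show "?e \<in> hcarrier (l2 S)"
          by (intro l2_scale_mem basis_vector_mem zero_mem)
        fix \<epsilon> :: real assume "\<epsilon> > 0"
        obtain F where F: "finite F" "F \<subseteq> S" and tail: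
          "\<And>h. \<lbrakk>\<forall>x. cmod (h x) \<le> cmod (g x); \<forall>x\<in>F. h x = 0\<rbrakk> \<Longrightarrow> hnorm (l2 S) h < \<epsilon>"
          using l2_tail[OF g \<open>\<epsilon> > 0\<close>] by blast
        \<comment> \<open>The point 0 must be removed from F, since the translate 0 + S is all of S.\<close>
        let ?h = "\<lambda>x. if \<exists>a\<in>F - {0}. x - a \<in> S then 0 else g x"
        have "?h \<in> M"
          using F by (intro restrict_outside_translates_mem[OF M inv] \<open>g \<in> M\<close>) auto
        \<comment> \<open>Pointedness: no translate by a nonzero element of S reaches 0.\<close>
        have h0: "?h 0 = g 0"
          using F(2) add_eq_0D[of _ "- _"] by fastforce
        moreover have "hnorm (l2 S) (?e - ?h) < \<epsilon>"
        proof (rule tail; safe)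
          fix x
          show "cmod ((?e - ?h) x) \<le> cmod (g x)"
            using h0 by (cases "x = 0") (auto simp: basis_vector_def)
        next
          fix x assume "x \<in> F"
          show "(?e - ?h) x = 0"
          proof (cases "x = 0")
            case True
            with h0 show ?thesis
              by (simp add: basis_vector_def)
          next
            case False
            then have "\<exists>a\<in>F - {0}. x - a \<in> S"
              using \<open>x \<in> F\<close> zero_mem by (intro bexI[of _ x]) auto
            with False show ?thesis
              by (simp add: basis_vector_def)
          qed
        qed
        ultimately show "\<exists>h\<in>M. hnorm (l2 S) (?e - h) < \<epsilon>"
          using \<open>?h \<in> M\<close> by blast
      qed
      then have "(\<lambda>x. inverse (g 0) * ?e x) \<in> M"
        by (rule MD(4))
      then have "basis_vector 0 \<in> M"
        using \<open>g 0 \<noteq> 0\<close> by (simp add: mult.assoc[symmetric])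
      then have "basis_vector a \<in> M" if "a \<in> S" for a
        using regular_representation_basis_vector[OF zero_mem, of a] inv(1)[OF that]
        by (metis add_0_right image_subset_iff)
      then have "M = hcarrier (l2 S)"
        by (rule closed_subspace_l2_eq_carrier[OF M])
      with \<open>M \<noteq> hcarrier (l2 S)\<close> show False ..
    qed
  qed
qed

section \<open>The generated inverse semigroup\<close>

text \<open>
  The induction has to carry the adjoint along: in the product case its membership follows
  from that for the two factors, since \<open>(XY)\<^sup>* = Y\<^sup>* X\<^sup>*\<close>.
\<close>

lemma generated_semigroup_translationE:
  assumes "X \<in> generated_semigroup S (l2 S) V"
  obtains g D where "translatable S g D" "X = partial_translation S g D"
    "partial_translation S (- g) ((\<lambda>b. b - g) ` D) \<in> generated_semigroup S (l2 S) V"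
proof -
  let ?P = "generated_semigroup S (l2 S) V"
  have "\<exists>g D. translatable S g D \<and> X = partial_translation S g D \<and>
      partial_translation S (- g) ((\<lambda>b. b - g) ` D) \<in> ?P"
    using assms
  proof induction
    case (gen a)
    then have "partial_translation S (- a) ((\<lambda>b. b - a) ` (+) a ` S) \<in> ?P"
      using generated_semigroup.gen_adjoint[where S = S and H = "l2 S" and V = V]
      by (simp add: adjoint_regular_representation image_image)
    then show ?case
      using gen regular_translatable regular_representation_eq by blast
  next
    case (gen_adjoint a)
    have "translatable S (- a) S"
      using add_mem[OF _ gen_adjoint] by (auto simp: translatable_def)
    moreover have "(\<lambda>b. b - (- a)) ` S = (+) a ` S"
      by (simp add: add.commute)
    then have "partial_translation S (- (- a)) ((\<lambda>b. b - (- a)) ` S) \<in> ?P"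
      using generated_semigroup.gen[where S = S and H = "l2 S" and V = V] gen_adjoint
      by (simp only: regular_representation_eq minus_minus)
    ultimately show ?case
      using adjoint_regular_representation[OF gen_adjoint] by blast
  next
    case (mult X Y)
    then obtain g D h E where X: "translatable S g D" "X = partial_translation S g D"
        "partial_translation S (- g) ((\<lambda>b. b - g) ` D) \<in> ?P"
      and Y: "translatable S h E" "Y = partial_translation S h E"
        "partial_translation S (- h) ((\<lambda>b. b - h) ` E) \<in> ?P"
      by blast
    let ?D = "{b \<in> D. b - g \<in> E}"
    \<comment> \<open>The sets occurring in \<open>(XY)\<^sup>*\<close> and in \<open>Y\<^sup>* X\<^sup>*\<close>: both are the domain of the product.\<close>
    have "(\<lambda>b. b - (g + h)) ` ?D = {b \<in> (\<lambda>b. b - h) ` E. b - (- h) \<in> (\<lambda>b. b - g) ` D}"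
    proof (intro equalityI subsetI)
      fix x assume "x \<in> (\<lambda>b. b - (g + h)) ` ?D"
      then obtain b where b: "b \<in> D" "b - g \<in> E" "x = (b - g) - h"
        by (auto simp: diff_diff_eq)
      then show "x \<in> {b \<in> (\<lambda>b. b - h) ` E. b - (- h) \<in> (\<lambda>b. b - g) ` D}"
        by auto
    next
      fix x assume "x \<in> {b \<in> (\<lambda>b. b - h) ` E. b - (- h) \<in> (\<lambda>b. b - g) ` D}"
      then obtain b where "b \<in> D" "b - g \<in> E" "x = (b - g) - h"
        by (auto simp: diff_eq_eq)
      then show "x \<in> (\<lambda>b. b - (g + h)) ` ?D"
        by (auto simp: diff_diff_eq)
    qed
    then have "partial_translation S (- (g + h)) ((\<lambda>b. b - (g + h)) ` ?D) =
        compose (hcarrier (l2 S)) (partial_translation S (- h) ((\<lambda>b. b - h) ` E))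
          (partial_translation S (- g) ((\<lambda>b. b - g) ` D))"
      by (simp add: compose_partial_translation[OF translatable_adjoint[OF X(1)]] minus_diff_commute)
    then have "partial_translation S (- (g + h)) ((\<lambda>b. b - (g + h)) ` ?D) \<in> ?P"
      using generated_semigroup.mult[OF Y(3) X(3)] by simp
    then show ?case
      using translatable_compose[OF X(1) Y(1)] compose_partial_translation[OF Y(1)] X(2) Y(2) by blast
  qed
  then show thesis
    using that by blast
qed

lemma inverse_semigroup_regular_representation:
  "inverse_semigroup (generated_semigroup S (l2 S) V) (compose (hcarrier (l2 S)))"
  unfolding inverse_semigroup_def
proof (intro conjI ballI)
  let ?P = "generated_semigroup S (l2 S) V" and ?c = "compose (hcarrier (l2 S))"
  fix X assume X: "X \<in> ?P"
  then obtain g D where gD: "translatable S g D" "X = partial_translation S g D"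
      "partial_translation S (- g) ((\<lambda>b. b - g) ` D) \<in> ?P"
    by (rule generated_semigroup_translationE)
  let ?X' = "partial_translation S (- g) ((\<lambda>b. b - g) ` D)"
  show "\<exists>!Y. Y \<in> ?P \<and> ?c (?c X Y) X = X \<and> ?c (?c Y X) Y = Y"
  proof (intro ex1I[of _ ?X'] conjI)
    show "?X' \<in> ?P"
      by (rule gD)
    show "?c (?c X ?X') X = X"
      unfolding gD(2) using gD(1) by (rule partial_translation_inverse)
    show "?c (?c ?X' X) ?X' = ?X'"
      using partial_translation_inverse[OF translatable_adjoint[OF gD(1)]]
      by (simp add: gD(2) image_image)
    fix Y assume Y: "Y \<in> ?P \<and> ?c (?c X Y) X = X \<and> ?c (?c Y X) Y = Y"
    then obtain h E where "translatable S h E" "Y = partial_translation S h E"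
      by (blast elim: generated_semigroup_translationE)
    then show "Y = ?X'"
      using Y partial_translation_inverse_unique[OF gD(1)] by (simp add: gD(2))
  qed
  fix Y assume Y: "Y \<in> ?P"
  show "?c X Y \<in> ?P"
    using X Y by (rule generated_semigroup.mult)
  fix Z assume "Z \<in> ?P"
  then obtain k C where "translatable S k C" "Z = partial_translation S k C"
    by (rule generated_semigroup_translationE)
  then have "Z \<in> hcarrier (l2 S) \<rightarrow> hcarrier (l2 S)"
    by (simp add: partial_translation_mem)
  then show "?c (?c X Y) Z = ?c X (?c Y Z)"
    by (rule compose_assoc[symmetric])
qed

lemma inverse_regular_representation: "inverse_representation S (l2 S) V"
  by (simp add: inverse_representation_def in_Delta_def isometric_regular_representation
      inj_regular_representation irreducible_regular_representation
      non_unitary_regular_representation inverse_semigroup_regular_representation)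

end

theorem lemma2p1:
  fixes P S :: "'g::ab_group_add set"
  assumes "positive_cone P"
    and "S \<subseteq> P"
    and "0 \<in> S"
    and "\<And>a b. a \<in> S \<Longrightarrow> b \<in> S \<Longrightarrow> a + b \<in> S"
  shows "inverse_representation S (l2 S) (regular_representation S)"
proof -
  have "a = 0" if "a \<in> S" "b \<in> S" "a + b = 0" for a b
  proof -
    have "a = - b"
      using that(3) by (simp add: eq_neg_iff_add_eq_0)
    then have "a \<in> P \<inter> uminus ` P"
      using that \<open>S \<subseteq> P\<close> by auto
    then show "a = 0"
      using assms(1) unfolding positive_cone_def by blast
  qed
  then interpret pointed_submonoid S
    using assms by unfold_locales
  show ?thesis
    by (rule inverse_regular_representation)
qed

end
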